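(* Let $E$ be a Banach space, let $z\in\mathbb C$, and let $f:S(z)\to E$ be a bounded, weakly-regular map. Assume further that $t\mapsto f(t)$ and $t\mapsto f(z+t)$ are norm continuous maps $\mathbb R\to E$. Then $f$ is norm-regular.
   Context: For $z\in\mathbb C\setminus\mathbb R$, $S(z)=\{w\in\mathbb C: 0\le \operatorname{Im} w/\operatorname{Im} z\le 1\}$ is the closed horizontal strip bounded by $\mathbb R$ and $\mathbb R+z$; for $z\in\mathbb R$, $S(z)=\mathbb R$. A map $f:S(z)\to E$ is weakly-regular if it is continuous for the weak topology on $E$, and analytic in the interior of $S(z)$ (equivalently, $\mu\circ f$ is complex differentiable in the interior for each $\mu\in E^*$). It is norm-regular if it is norm continuous on $S(z)$ and analytic in the interior of $S(z)$. *)

theory Defs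
  imports "HOL-Analysis.Analysis"
begin

text \<open>The library has only real Banach spaces. Here the complex scalar multiplication extends the real one and the norm
  is homogeneous with respect to it.\<close>

class complex_normed_vector = real_normed_vector +
  fixes scaleC :: "complex \<Rightarrow> 'a \<Rightarrow> 'a"  (infixr "*\<^sub>C" 75)
  assumes scaleC_add_right: "a *\<^sub>C (x + y) = a *\<^sub>C x + a *\<^sub>C y"
    and scaleC_add_left: "(a + b) *\<^sub>C x = a *\<^sub>C x + b *\<^sub>C x"
    and scaleC_scaleC: "a *\<^sub>C b *\<^sub>C x = (a * b) *\<^sub>C x"
    and scaleR_scaleC: "r *\<^sub>R x = complex_of_real r *\<^sub>C x"
    and norm_scaleC: "norm (a *\<^sub>C x) = cmod a * norm x"

class complex_banach = complex_normed_vector + complete_space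

subclass (in complex_banach) banach ..

instantiation complex :: complex_banach
begin

definition scaleC_complex :: "complex \<Rightarrow> complex \<Rightarrow> complex" where
  "scaleC_complex a x = a * x"

instance
  by standard (auto simp: scaleC_complex_def algebra_simps norm_mult scaleR_conv_of_real)

end

definition dual_space :: "('a::complex_normed_vector \<Rightarrow> complex) set" where
  "dual_space = {\<mu>. bounded_linear \<mu> \<and> (\<forall>c x. \<mu> (c *\<^sub>C x) = c * \<mu> x)}"

definition weak_topology :: "'a::complex_normed_vector topology" where
  "weak_topology = topology_generated_by {\<mu> -` U |\<mu> U. \<mu> \<in> dual_space \<and> open U}"

text \<open>The total derivative is taken with respect to the norm of \<^typ>\<open>'a\<close>; requiring it to be
  of the form \<open>h \<mapsto> h *\<^sub>C D\<close> is complex differentiability. This is analyticity only for open \<open>U\<close>.\<close>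

definition analytic_in :: "(complex \<Rightarrow> 'a::complex_normed_vector) \<Rightarrow> complex set \<Rightarrow> bool" where
  "analytic_in f U \<longleftrightarrow> (\<forall>w\<in>U. \<exists>D. (f has_derivative (\<lambda>h. h *\<^sub>C D)) (at w))"

definition strip :: "complex \<Rightarrow> complex set" where
  "strip z = (if z \<in> \<real> then \<real> else {w. 0 \<le> Im w / Im z \<and> Im w / Im z \<le> 1})"

definition weakly_regular :: "complex \<Rightarrow> (complex \<Rightarrow> 'a::complex_normed_vector) \<Rightarrow> bool" where
  "weakly_regular z f \<longleftrightarrow>
     continuous_map (top_of_set (strip z)) weak_topology f \<and> analytic_in f (interior (strip z))"

definition norm_regular :: "complex \<Rightarrow> (complex \<Rightarrow> 'a::complex_normed_vector) \<Rightarrow> bool" where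
  "norm_regular z f \<longleftrightarrow>
     continuous_on (strip z) f \<and> analytic_in f (interior (strip z))"

lemma continuous_map_weak_topology_iff:
  fixes f :: "complex \<Rightarrow> 'a::complex_normed_vector"
  shows
  "continuous_map (top_of_set S) weak_topology f \<longleftrightarrow>
     (\<forall>\<mu>\<in>dual_space. continuous_on S (\<lambda>w. \<mu> (f w)))"
proof -
  have "(\<lambda>x. 0) \<in> dual_space" by (simp add: dual_space_def)
  then have cover: "\<Union>{\<mu> -` U |\<mu> U. \<mu> \<in> (dual_space::('a \<Rightarrow> complex) set) \<and> open U} = UNIV"
    by (auto intro!: exI[of _ UNIV])
  have "continuous_map (top_of_set S) weak_topology f \<longleftrightarrow>
      (\<forall>V\<in>{\<mu> -` U |\<mu> U. \<mu> \<in> dual_space \<and> open U}. openin (top_of_set S) (f -` V \<inter> S))"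
    unfolding weak_topology_def continuous_on_generated_topo_iff cover by auto
  also have "\<dots> \<longleftrightarrow>
      (\<forall>\<mu>\<in>dual_space. \<forall>U. open U \<longrightarrow> openin (top_of_set S) (f -` (\<mu> -` U) \<inter> S))"
    by blast
  also have "\<dots> \<longleftrightarrow>
      (\<forall>\<mu>\<in>dual_space. \<forall>U. open U \<longrightarrow> openin (top_of_set S) (S \<inter> (\<lambda>w. \<mu> (f w)) -` U))"
    by (simp add: vimage_def Int_commute)
  finally show ?thesis
    by (simp add: continuous_openin_preimage_eq)
qed

lemma analytic_in_imp_weakly_differentiable:
  assumes "analytic_in f U" "\<mu> \<in> dual_space" "w \<in> U"
  shows "(\<lambda>w. \<mu> (f w)) field_differentiable (at w)"
proof -
  obtain D where D: "(f has_derivative (\<lambda>h. h *\<^sub>C D)) (at w)"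
    using assms(1,3) by (auto simp: analytic_in_def)
  have \<mu>: "bounded_linear \<mu>" "\<And>c x. \<mu> (c *\<^sub>C x) = c * \<mu> x"
    using assms(2) by (auto simp: dual_space_def)
  have "((\<lambda>w. \<mu> (f w)) has_derivative (*) (\<mu> D)) (at w)"
    using bounded_linear.has_derivative[OF \<mu>(1) D] by (simp add: \<mu>(2) mult_commute_abs)
  then show ?thesis
    by (auto simp: field_differentiable_def has_field_derivative_def)
qed

end

theory Submission
  imports Defs "HOL-Complex_Analysis.Conformal_Mappings"
begin

text \<open>Continuity in the interior is clear, so only a boundary point \<open>p\<close> matters. There, for every functional
  \<open>\<mu>\<close> of norm at most one, \<open>\<mu> \<circ> f - \<mu> (f p)\<close> is small on the boundary line near \<open>p\<close>, uniformly in \<open>\<mu>\<close>,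
  and bounded on the rest of a half disc around \<open>p\<close>. The maximum principle, applied after damping by a
  holomorphic barrier independent of \<open>\<mu>\<close>, makes it small near \<open>p\<close> in the strip, again uniformly in \<open>\<mu>\<close>.
  By Hahn-Banach, the supremum over \<open>\<mu>\<close> is the norm of \<open>f - f p\<close>.\<close>

section \<open>Norming functionals\<close>

definition sublinear :: "('a::real_vector \<Rightarrow> real) \<Rightarrow> bool" where
  "sublinear p \<longleftrightarrow> (\<forall>x y. p (x + y) \<le> p x + p y) \<and> (\<forall>c x. 0 \<le> c \<longrightarrow> p (c *\<^sub>R x) \<le> c * p x)"

lemma sublinear_add: "sublinear p \<Longrightarrow> p (x + y) \<le> p x + p y"
  by (simp add: sublinear_def)

lemma sublinear_scaleR_le: "sublinear p \<Longrightarrow> 0 \<le> c \<Longrightarrow> p (c *\<^sub>R x) \<le> c * p x"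
  by (simp add: sublinear_def)

lemma sublinear_zero: "sublinear p \<Longrightarrow> p 0 = 0"
  using sublinear_add[of p 0 0] sublinear_scaleR_le[of p 0 0] by simp

text \<open>The definition asks only for the inequality, which is easier to check for infima;
  applying it with \<open>inverse c\<close> to \<open>c *\<^sub>R x\<close> gives the other
  direction.\<close>

lemma sublinear_scaleR:
  assumes "sublinear p" "0 \<le> c"
  shows "p (c *\<^sub>R x) = c * p x"
proof (cases "c = 0")
  case True
  then show ?thesis using sublinear_zero[OF assms(1)] by simp
next
  case False
  then have c: "c > 0" using assms(2) by simp
  have "p (inverse c *\<^sub>R c *\<^sub>R x) \<le> inverse c * p (c *\<^sub>R x)"
    using sublinear_scaleR_le[OF assms(1), of "inverse c" "c *\<^sub>R x"] c by simp
  then have "c * p x \<le> p (c *\<^sub>R x)" using c by (simp add: field_simps)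
  then show ?thesis using sublinear_scaleR_le[OF assms, of x] by simp
qed

lemma sublinear_minus: "sublinear p \<Longrightarrow> - p (- x) \<le> p x"
  using sublinear_add[of p x "- x"] sublinear_zero[of p] by simp

text \<open>For sublinear \<open>p\<close> this is the largest sublinear functional below
  \<open>p\<close> whose value at \<open>- y\<close> is at most \<open>- p y\<close>. A linear
  functional below it is therefore at least \<open>p y\<close> at \<open>y\<close>.\<close>

definition tilt :: "('a::real_vector \<Rightarrow> real) \<Rightarrow> 'a \<Rightarrow> 'a \<Rightarrow> real" where
  "tilt p y x = (INF t\<in>{0..}. p (x + t *\<^sub>R y) - t * p y)"

lemma tilt_le:
  assumes "sublinear p" "0 \<le> t"
  shows "tilt p y x \<le> p (x + t *\<^sub>R y) - t * p y"
  unfolding tilt_def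
proof (rule cINF_lower)
  show "bdd_below ((\<lambda>t. p (x + t *\<^sub>R y) - t * p y) ` {0..})"
  \<comment> \<open>Subadditivity gives
    \<open>t * p y \<le> p (x + t *\<^sub>R y) + p (- x)\<close>, a lower bound independent of
    \<open>t\<close>.\<close>
  proof (rule bdd_belowI2)
    fix t :: real assume "t \<in> {0..}"
    then show "- p (- x) \<le> p (x + t *\<^sub>R y) - t * p y"
      using sublinear_add[OF assms(1), of "x + t *\<^sub>R y" "- x"] sublinear_scaleR[OF assms(1), of t y]
      by simp
  qed
qed (use assms in auto)

lemma tilt_greatest:
  "(\<And>t. 0 \<le> t \<Longrightarrow> b \<le> p (x + t *\<^sub>R y) - t * p y) \<Longrightarrow> b \<le> tilt p y x"
  unfolding tilt_def by (rule cINF_greatest) auto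

lemma sublinear_tilt:
  assumes p: "sublinear p"
  shows "sublinear (tilt p y)"
proof -
  have add: "tilt p y (x + x') \<le> tilt p y x + tilt p y x'" for x x'
  proof -
    have *: "tilt p y (x + x') \<le> (p (x + t *\<^sub>R y) - t * p y) + (p (x' + s *\<^sub>R y) - s * p y)"
      if "0 \<le> t" "0 \<le> s" for s t
    proof -
      have "tilt p y (x + x') \<le> p (x + x' + (t + s) *\<^sub>R y) - (t + s) * p y"
        using that by (intro tilt_le p) auto
      also have "x + x' + (t + s) *\<^sub>R y = (x + t *\<^sub>R y) + (x' + s *\<^sub>R y)"
        by (simp add: scaleR_add_left)
      finally show ?thesis
        using sublinear_add[OF p, of "x + t *\<^sub>R y" "x' + s *\<^sub>R y"] by (simp add: algebra_simps)
    qed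
    \<comment> \<open>The two infima are taken one after the other: first over \<open>s\<close> with
      \<open>t\<close> fixed, then over \<open>t\<close>.\<close>
    have "tilt p y (x + x') - (p (x + t *\<^sub>R y) - t * p y) \<le> tilt p y x'" if "0 \<le> t" for t
      using *[OF that] by (intro tilt_greatest) (simp add: algebra_simps)
    then have "tilt p y (x + x') - tilt p y x' \<le> tilt p y x"
      by (intro tilt_greatest) (simp add: algebra_simps)
    then show ?thesis by simp
  qed
  have scale: "tilt p y (c *\<^sub>R x) \<le> c * tilt p y x" if c: "0 \<le> c" for c x
  proof (cases "c = 0")
    case True
    then show ?thesis using tilt_le[OF p, of 0 y 0] sublinear_zero[OF p] by simp
  next
    case False
    then have c: "c > 0" using c by simp
    have "tilt p y (c *\<^sub>R x) / c \<le> p (x + t *\<^sub>R y) - t * p y" if t: "0 \<le> t" for t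
    proof -
      \<comment> \<open>The parameter \<open>c * t\<close> for \<open>c *\<^sub>R x\<close>
        corresponds to \<open>t\<close> for \<open>x\<close>.\<close>
      have "tilt p y (c *\<^sub>R x) \<le> p (c *\<^sub>R x + (c * t) *\<^sub>R y) - (c * t) * p y"
        using c t by (intro tilt_le p) auto
      also have "c *\<^sub>R x + (c * t) *\<^sub>R y = c *\<^sub>R (x + t *\<^sub>R y)"
        by (simp add: scaleR_add_right)
      finally show ?thesis
        using c sublinear_scaleR[OF p, of c "x + t *\<^sub>R y"] by (simp add: field_simps)
    qed
    then have "tilt p y (c *\<^sub>R x) / c \<le> tilt p y x" by (rule tilt_greatest)
    then show ?thesis using c by (simp add: field_simps)
  qed
  show ?thesis using add scale by (simp add: sublinear_def)
qed

lemma tilt_le_self: "sublinear p \<Longrightarrow> tilt p y x \<le> p x"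
  using tilt_le[of p 0 y x] by simp

text \<open>A pointwise infimum of sublinear functionals need not be subadditive. In a chain, the
  smaller of \<open>q\<close> and \<open>q'\<close> serves at both points, which bounds the infimum
  at \<open>x + y\<close> by \<open>q x + q' y\<close>.\<close>

lemma sublinear_INF_chain:
  fixes C :: "('a::real_vector \<Rightarrow> real) set"
  assumes ne: "C \<noteq> {}" and sub: "\<And>q. q \<in> C \<Longrightarrow> sublinear q"
    and bdd: "\<And>q x. q \<in> C \<Longrightarrow> b x \<le> q x"
    and chain: "\<And>q q'. q \<in> C \<Longrightarrow> q' \<in> C \<Longrightarrow> q \<le> q' \<or> q' \<le> q"
  shows "sublinear (\<lambda>x. INF q\<in>C. q x)"
proof -
  define u where "u = (\<lambda>x. INF q\<in>C. q x)"
  have low: "u x \<le> q x" if "q \<in> C" for q x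
    unfolding u_def using that bdd by (intro cINF_lower bdd_belowI2[where m = "b x"]) auto
  have gr: "a \<le> u x" if "\<And>q. q \<in> C \<Longrightarrow> a \<le> q x" for a x
    unfolding u_def using ne that by (rule cINF_greatest)
  have add: "u (x + y) \<le> u x + u y" for x y
  proof -
    have *: "u (x + y) \<le> q x + q' y" if q: "q \<in> C" "q' \<in> C" for q q'
      using chain[OF q]
    proof
      assume "q \<le> q'"
      then show ?thesis
        using low[OF q(1), of "x + y"] sublinear_add[OF sub[OF q(1)], of x y] le_funD[of q q' y] by simp
    next
      assume "q' \<le> q"
      then show ?thesis
        using low[OF q(2), of "x + y"] sublinear_add[OF sub[OF q(2)], of x y] le_funD[of q' q x] by simp
    qed
    have "u (x + y) - q x \<le> u y" if "q \<in> C" for q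
      using *[OF that] by (intro gr) (simp add: algebra_simps)
    then have "u (x + y) - u y \<le> u x"
      by (intro gr) (simp add: algebra_simps)
    then show ?thesis by simp
  qed
  have scale: "u (c *\<^sub>R x) \<le> c * u x" if c: "0 \<le> c" for c x
  proof (cases "c = 0")
    case True
    then show ?thesis using ne low[of _ 0] sublinear_zero[OF sub] by fastforce
  next
    case False
    then have c: "c > 0" using c by simp
    have "u (c *\<^sub>R x) / c \<le> q x" if "q \<in> C" for q
      using low[OF that, of "c *\<^sub>R x"] sublinear_scaleR[OF sub[OF that], of c x] c
      by (simp add: field_simps)
    then have "u (c *\<^sub>R x) / c \<le> u x" by (rule gr)
    then show ?thesis using c by (simp add: field_simps)
  qed
  show ?thesis using add scale by (simp add: sublinear_def u_def)
qed

text \<open>Zorn's lemma for the reversed pointwise order: the infimum of a nonempty chain is again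
  sublinear, and \<open>p\<close> itself bounds the empty chain.\<close>

lemma minimal_sublinear_exists:
  fixes p :: "'a::real_vector \<Rightarrow> real"
  assumes p: "sublinear p"
  obtains m where "sublinear m" "m \<le> p" "\<And>q. sublinear q \<Longrightarrow> q \<le> m \<Longrightarrow> q = m"
proof -
  define A where "A = {q. sublinear q \<and> q \<le> p}"
  \<comment> \<open>From \<open>q \<le> p\<close> follows
    \<open>- p (- x) \<le> - q (- x) \<le> q x\<close>, so all infima over chains are
    finite.\<close>
  have bdd: "- p (- x) \<le> q x" if "q \<in> A" for q x
    using that sublinear_minus[of q x] le_funD[of q p "- x"] by (simp add: A_def)
  have "\<exists>m\<in>A. \<forall>a\<in>A. a \<le> m \<longrightarrow> a = m"
  proof (rule predicate_Zorn)
    show "partial_order_on A (relation_of (\<lambda>x y. y \<le> x) A)"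
      by (rule partial_order_on_relation_ofI) auto
  next
    fix C assume C: "C \<in> Chains (relation_of (\<lambda>x y. y \<le> x) A)"
    have CA: "C \<subseteq> A" using C by (auto simp: Chains_def relation_of_def)
    have chain: "q \<le> q' \<or> q' \<le> q" if "q \<in> C" "q' \<in> C" for q q'
      using C that by (auto simp: Chains_def relation_of_def)
    show "\<exists>u\<in>A. \<forall>a\<in>C. u \<le> a"
    proof (cases "C = {}")
      case True
      then show ?thesis using p by (auto simp: A_def)
    next
      case False
      define u where "u = (\<lambda>x. INF q\<in>C. q x)"
      have low: "u x \<le> q x" if "q \<in> C" for q x
        unfolding u_def using that bdd CA
        by (intro cINF_lower bdd_belowI2[where m = "- p (- x)"]) auto
      have "sublinear u"
        unfolding u_def
      proof (rule sublinear_INF_chain[OF False])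
        show "- p (- x) \<le> q x" if "q \<in> C" for q x using bdd CA that by auto
      qed (use CA chain in \<open>auto simp: A_def\<close>)
      moreover obtain q where "q \<in> C" using False by auto
      then have "u \<le> p" using low[of q] CA by (force simp: A_def le_fun_def intro: order_trans)
      ultimately have "u \<in> A" by (simp add: A_def)
      moreover have "\<forall>a\<in>C. u \<le> a" using low by (auto simp: le_fun_def)
      ultimately show ?thesis by blast
    qed
  qed
  then obtain m where m: "m \<in> A" and min: "\<And>a. a \<in> A \<Longrightarrow> a \<le> m \<Longrightarrow> a = m" by blast
  show ?thesis
  proof (rule that)
    show "sublinear m" "m \<le> p" using m by (auto simp: A_def)
    show "q = m" if "sublinear q" "q \<le> m" for q
      using that m by (intro min) (auto simp: A_def)
  qed
qed

text \<open>A minimal sublinear functional equals each of its tilts, and this forces additivity.\<close>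

lemma sublinear_dominates_linear:
  fixes p :: "'a::real_vector \<Rightarrow> real"
  assumes "sublinear p"
  obtains g where "linear g" "\<And>x. g x \<le> p x"
proof -
  obtain m where m: "sublinear m" and mp: "m \<le> p"
    and min: "\<And>q. sublinear q \<Longrightarrow> q \<le> m \<Longrightarrow> q = m"
    by (rule minimal_sublinear_exists[OF assms]) blast
  have tilt: "tilt m y = m" for y
    using tilt_le_self[OF m] by (intro min sublinear_tilt m) (auto simp: le_fun_def)
  have add: "m (x + y) = m x + m y" for x y
  proof -
    have "m x \<le> m (x + y) - m y" using tilt_le[OF m, of 1 y x] by (simp add: tilt)
    then show ?thesis using sublinear_add[OF m, of x y] by simp
  qed
  have minus: "m (- x) = - m x" for x
    using add[of x "- x"] sublinear_zero[OF m] by simp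
  have scale: "m (c *\<^sub>R x) = c * m x" for c x
  proof (cases "0 \<le> c")
    case True
    then show ?thesis by (rule sublinear_scaleR[OF m])
  next
    case False
    then have "m ((- c) *\<^sub>R (- x)) = - c * m (- x)" by (intro sublinear_scaleR m) simp
    then show ?thesis by (simp add: minus)
  qed
  have "linear m" using add scale by (intro linearI) auto
  then show ?thesis using that mp by (auto simp: le_fun_def)
qed

text \<open>Dominating by the tilt of the norm along \<open>x0\<close>, rather than by the norm,
  forces \<open>g (- x0) \<le> - norm x0\<close>; no extension from the line through
  \<open>x0\<close> is involved.\<close>

lemma real_norming_functional:
  fixes x0 :: "'a::real_normed_vector"
  obtains g where "linear g" "\<And>x. g x \<le> norm x" "g x0 = norm x0"
proof -
  have n: "sublinear (norm :: 'a \<Rightarrow> real)"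
    by (simp add: sublinear_def norm_triangle_ineq)
  obtain g where g: "linear g" and le: "\<And>x. g x \<le> tilt norm x0 x"
    using sublinear_dominates_linear[OF sublinear_tilt[OF n, of x0]] by blast
  have gn: "g x \<le> norm x" for x
    using le[of x] tilt_le_self[OF n, of x0 x] by simp
  have "g (- x0) \<le> - norm x0"
    using le[of "- x0"] tilt_le[OF n, of 1 x0 "- x0"] by simp
  then have "g x0 = norm x0"
    using gn[of x0] linear_neg[OF g, of x0] by simp
  then show ?thesis using that g gn by blast
qed

lemma norming_functional:
  fixes x0 :: "'a::complex_normed_vector"
  obtains \<mu> where "\<mu> \<in> dual_space" "\<And>x. cmod (\<mu> x) \<le> norm x" "cmod (\<mu> x0) = norm x0"
proof -
  obtain g where g: "linear g" and gn: "\<And>x. g x \<le> norm x" and g0: "g x0 = norm x0"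
    by (rule real_norming_functional) blast
  \<comment> \<open>The only complex linear functional with real part \<open>g\<close>.\<close>
  define \<mu> where "\<mu> = (\<lambda>x. Complex (g x) (- g (\<i> *\<^sub>C x)))"
  have add: "\<mu> (x + y) = \<mu> x + \<mu> y" for x y
    by (simp add: \<mu>_def scaleC_add_right linear_add[OF g] complex_eq_iff)
  have gC: "g (c *\<^sub>C x) = Re c * g x + Im c * g (\<i> *\<^sub>C x)" for c x
  proof -
    have "c *\<^sub>C x = (complex_of_real (Re c) + complex_of_real (Im c) * \<i>) *\<^sub>C x"
      by (metis complex_eq mult.commute)
    also have "\<dots> = Re c *\<^sub>R x + Im c *\<^sub>R (\<i> *\<^sub>C x)"
      by (simp only: scaleC_add_left scaleR_scaleC scaleC_scaleC)
    finally show ?thesis by (simp add: linear_add[OF g] linear_scale[OF g])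
  qed
  have scale: "\<mu> (c *\<^sub>C x) = c * \<mu> x" for c x
    using gC[of c x] gC[of "\<i> * c" x] by (simp add: \<mu>_def scaleC_scaleC complex_eq_iff)
  have norm_le: "cmod (\<mu> x) \<le> norm x" for x
  proof (cases "\<mu> x = 0")
    case False
    \<comment> \<open>The phase \<open>c\<close> turns \<open>\<mu> x\<close> into its modulus, so
      the modulus is the real part of \<open>\<mu> (c *\<^sub>C x)\<close>, where the bound on
      \<open>g\<close> applies.\<close>
    define c where "c = cnj (sgn (\<mu> x))"
    have "c * \<mu> x = complex_of_real (cmod (\<mu> x))"
      using False by (simp add: c_def sgn_div_norm scaleR_conv_of_real field_simps power2_eq_square
          flip: complex_norm_square)
    then have "cmod (\<mu> x) = Re (\<mu> (c *\<^sub>C x))" by (simp add: scale)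
    also have "\<dots> \<le> norm (c *\<^sub>C x)" using gn by (simp add: \<mu>_def)
    also have "\<dots> = norm x" using False by (simp add: norm_scaleC c_def norm_sgn)
    finally show ?thesis .
  qed simp
  have "bounded_linear \<mu>"
  proof (rule bounded_linear_intro[where K = 1])
    show "\<mu> (r *\<^sub>R x) = r *\<^sub>R \<mu> x" for r x
      by (simp only: scaleR_scaleC[of r x] scale scaleR_conv_of_real)
  qed (use add norm_le in auto)
  then have "\<mu> \<in> dual_space" by (simp add: dual_space_def scale)
  moreover have "norm x0 \<le> cmod (\<mu> x0)"
    using complex_Re_le_cmod[of "\<mu> x0"] g0 by (simp add: \<mu>_def)
  then have "cmod (\<mu> x0) = norm x0" using norm_le[of x0] by simp
  ultimately show ?thesis using that norm_le by blast
qed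

section \<open>Boundary continuity\<close>

text \<open>The barrier \<open>u\<close> is the real part of \<open>w\<^sup>2 - 2 r \<i> w\<close>; on the upper half of the circle of radius
  \<open>r\<close> it is at least \<open>r\<^sup>2\<close>, so damping by \<open>exp (- N u)\<close> makes the bound \<open>M\<close> there harmless.\<close>

lemma half_disc_bound:
  fixes h :: "complex \<Rightarrow> complex" and r e M N :: real
  defines "H \<equiv> cball 0 r \<inter> {w. 0 \<le> Im w}"
  defines "u \<equiv> \<lambda>w. (Re w)\<^sup>2 - (Im w)\<^sup>2 + 2 * r * Im w"
  assumes r: "0 < r" and N: "0 \<le> N"
    and cont: "continuous_on H h"
    and holo: "h holomorphic_on ball 0 r \<inter> {w. 0 < Im w}"
    and base: "\<And>w. w \<in> H \<Longrightarrow> Im w = 0 \<Longrightarrow> cmod (h w) \<le> e"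
    and bdd: "\<And>w. w \<in> H \<Longrightarrow> cmod (h w) \<le> M"
    and MN: "M * exp (- N * r\<^sup>2) \<le> e" and M: "0 \<le> M"
    and w: "w \<in> H"
  shows "cmod (h w) \<le> e * exp (N * u w)"
proof -
  define k where "k = (\<lambda>w. h w * exp (- of_real N * (w\<^sup>2 - 2 * of_real r * \<i> * w)))"
  have norm_k: "cmod (k w) = cmod (h w) * exp (- (N * u w))" for w
    by (simp add: k_def norm_mult u_def power2_eq_square algebra_simps)
  have clH: "closed H" unfolding H_def
    by (intro closed_Int closed_cball closed_halfspace_Im_ge)
  have int: "interior H = ball 0 r \<inter> {w. 0 < Im w}"
    using interior_halfspace_ge[of \<i> 0] by (simp add: H_def inner_complex_def)
  have frontier: "frontier H \<subseteq> {w \<in> H. Im w = 0 \<or> cmod w = r}"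
    unfolding frontier_def closure_closed[OF clH] int by (auto simp: H_def)
  have "cmod (k w) \<le> e"
  proof (rule maximum_modulus_frontier[of k H])
    show "k holomorphic_on interior H"
      unfolding k_def int using holo by (intro holomorphic_intros)
    show "continuous_on (closure H) k"
      unfolding k_def closure_closed[OF clH] using cont by (intro continuous_intros)
    show "bounded H" unfolding H_def by (intro bounded_Int) simp
    show "w \<in> H" by (rule w)
    fix v assume "v \<in> frontier H"
    then have v: "v \<in> H" and "Im v = 0 \<or> cmod v = r" using frontier by auto
    then show "cmod (k v) \<le> e"
    proof (elim disjE)
      assume "Im v = 0"
      \<comment> \<open>On the real axis the barrier is the square of \<open>Re v\<close>, so
        damping does not increase the modulus.\<close>
      then have "0 \<le> N * u v" using N by (simp add: u_def)
      then have "cmod (k v) \<le> cmod (h v)"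
        by (simp add: norm_k mult_left_le)
      then show ?thesis using base[OF v \<open>Im v = 0\<close>] by simp
    next
      assume a: "cmod v = r"
      have im: "0 \<le> Im v" using v by (simp add: H_def)
      have "Im v \<le> r" using a abs_Im_le_cmod[of v] by simp
      \<comment> \<open>On the arc, \<open>u v = r\<^sup>2 + 2 * Im v * (r - Im v)\<close>, and both
        factors are nonnegative.\<close>
      then have "Im v * Im v \<le> r * Im v" using im by (intro mult_right_mono)
      moreover have "(Re v)\<^sup>2 + (Im v)\<^sup>2 = r\<^sup>2" using a cmod_power2[of v] by simp
      ultimately have "r\<^sup>2 \<le> u v" by (simp add: u_def power2_eq_square)
      then have "N * r\<^sup>2 \<le> N * u v" using N by (rule mult_left_mono)
      then have "cmod (k v) \<le> M * exp (- N * r\<^sup>2)"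
        unfolding norm_k using bdd[OF v] M by (intro mult_mono) auto
      then show ?thesis using MN by simp
    qed
  qed
  then show ?thesis by (simp add: norm_k exp_minus field_simps)
qed

text \<open>The constants \<open>s\<close>, \<open>M\<close> and \<open>N\<close> are fixed before
  any functional is chosen, so the scalar estimates carry over to the norm.\<close>

lemma half_disc_norm_continuous:
  fixes g :: "complex \<Rightarrow> 'a::complex_normed_vector" and r :: real
  defines "H \<equiv> \<lambda>r. cball 0 r \<inter> {w. 0 \<le> Im w}"
  assumes r: "0 < r" and bdd: "bounded (g ` H r)"
    and cont: "\<And>\<mu>. \<mu> \<in> dual_space \<Longrightarrow> continuous_on (H r) (\<lambda>w. \<mu> (g w))"
    and holo: "\<And>\<mu>. \<mu> \<in> dual_space \<Longrightarrow> (\<lambda>w. \<mu> (g w)) holomorphic_on ball 0 r \<inter> {w. 0 < Im w}"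
    and real: "isCont (\<lambda>t::real. g (of_real t)) 0"
  shows "(g \<longlongrightarrow> g 0) (at 0 within {w. 0 \<le> Im w})"
proof (rule tendstoI)
  fix e :: real assume e: "0 < e"
  obtain B where B: "0 < B" "\<And>w. w \<in> H r \<Longrightarrow> norm (g w) \<le> B"
    using bdd by (auto simp: bounded_pos)
  obtain d where d: "0 < d" and dg: "\<And>t. \<bar>t\<bar> < d \<Longrightarrow> norm (g (of_real t) - g 0) < e / 2"
    using real e unfolding continuous_at_eps_delta dist_norm
    by (metis diff_zero half_gt_zero of_real_0 real_norm_def)
  \<comment> \<open>Halving \<open>d\<close> keeps the real points of the closed disc strictly
    within distance \<open>d\<close> of 0.\<close>
  define s where "s = min r (d / 2)"
  have s: "0 < s" "s \<le> r" "s < d" using r d by (auto simp: s_def)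
  have Hs: "H s \<subseteq> H r" using s by (auto simp: H_def)
  have zero: "0 \<in> H r" using r by (simp add: H_def)
  define M where "M = 2 * B"
  obtain N where N: "0 \<le> N" "M * exp (- N * s\<^sup>2) \<le> e / 2"
  proof
    \<comment> \<open>Solves \<open>M * exp (- N * s\<^sup>2) = e / 2\<close> for \<open>N\<close>;
      the maximum covers a negative logarithm.\<close>
    define N where "N = max 0 (ln (2 * M / e) / s\<^sup>2)"
    show "0 \<le> N" by (simp add: N_def)
    have "ln (2 * M / e) \<le> N * s\<^sup>2" using s by (simp add: N_def field_simps max_def)
    then have "exp (ln (2 * M / e)) \<le> exp (N * s\<^sup>2)" by simp
    then have "2 * M / e \<le> exp (N * s\<^sup>2)" using e B by (simp add: M_def)
    then show "M * exp (- N * s\<^sup>2) \<le> e / 2"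
      using e by (simp add: exp_minus field_simps)
  qed
  define u where "u = (\<lambda>w. (Re w)\<^sup>2 - (Im w)\<^sup>2 + 2 * s * Im w)"
  have bound: "norm (g w - g 0) \<le> e / 2 * exp (N * u w)" if w: "w \<in> H s" for w
  proof -
    \<comment> \<open>The functional may depend on \<open>w\<close>, since the bound obtained from
      it does not depend on the functional.\<close>
    obtain \<mu> where \<mu>: "\<mu> \<in> dual_space" and le: "\<And>x. cmod (\<mu> x) \<le> norm x"
      and eq: "cmod (\<mu> (g w - g 0)) = norm (g w - g 0)"
      by (rule norming_functional) blast
    have lin: "linear \<mu>" using \<mu> by (simp add: dual_space_def bounded_linear.linear)
    have "cmod (\<mu> (g w) - \<mu> (g 0)) \<le> e / 2 * exp (N * u w)"
      unfolding u_def
    proof (rule half_disc_bound[where M = M])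
      show "continuous_on (cball 0 s \<inter> {w. 0 \<le> Im w}) (\<lambda>w. \<mu> (g w) - \<mu> (g 0))"
        using continuous_on_subset[OF cont[OF \<mu>] Hs] unfolding H_def by (intro continuous_intros)
      show "(\<lambda>w. \<mu> (g w) - \<mu> (g 0)) holomorphic_on ball 0 s \<inter> {w. 0 < Im w}"
        using s by (intro holomorphic_intros holomorphic_on_subset[OF holo[OF \<mu>]]) auto
      show "cmod (\<mu> (g v) - \<mu> (g 0)) \<le> e / 2"
        if "v \<in> cball 0 s \<inter> {w. 0 \<le> Im w}" "Im v = 0" for v
      proof -
        have v: "v = of_real (Re v)" using that by (simp add: complex_eq_iff)
        have "\<bar>Re v\<bar> < d" using that s abs_Re_le_cmod[of v] by simp
        then have "norm (g v - g 0) < e / 2" using dg v by metis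
        then show ?thesis using le[of "g v - g 0"] by (simp add: linear_diff[OF lin])
      qed
      show "cmod (\<mu> (g v) - \<mu> (g 0)) \<le> M"
        if "v \<in> cball 0 s \<inter> {w. 0 \<le> Im w}" for v
      proof -
        have "norm (g v - g 0) \<le> B + B"
          using norm_triangle_ineq4[of "g v" "g 0"] B(2)[of v] B(2)[OF zero] that Hs
          by (auto simp: H_def)
        then show ?thesis using le[of "g v - g 0"] by (simp add: linear_diff[OF lin] M_def)
      qed
    qed (use s N B w in \<open>auto simp: M_def H_def\<close>)
    then show ?thesis using eq by (simp add: linear_diff[OF lin])
  qed
  \<comment> \<open>The barrier vanishes at 0, so the bound tends to \<open>e / 2\<close>, strictly
    below \<open>e\<close>.\<close>
  have "((\<lambda>w. e / 2 * exp (N * u w)) \<longlongrightarrow> e / 2 * exp (N * u 0)) (at 0 within {w. 0 \<le> Im w})"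
    unfolding u_def by (intro tendsto_intros)
  then have "\<forall>\<^sub>F w in at 0 within {w. 0 \<le> Im w}. e / 2 * exp (N * u w) < e"
    by (rule order_tendstoD) (use e in \<open>simp add: u_def\<close>)
  moreover have "\<forall>\<^sub>F w in at 0 within {w. 0 \<le> Im w}. w \<in> H s"
    unfolding eventually_at H_def using s by (intro exI[of _ s]) auto
  ultimately show "\<forall>\<^sub>F w in at 0 within {w. 0 \<le> Im w}. dist (g w) (g 0) < e"
    by eventually_elim (use bound in \<open>force simp: dist_norm\<close>)
qed

text \<open>The map \<open>w \<mapsto> p + s * w\<close> carries the half disc at 0 to one at
  \<open>p\<close> inside \<open>S\<close>. The sign \<open>s\<close> points the imaginary direction
  into \<open>S\<close>, so that a single lemma serves both boundary lines, whether \<open>S\<close>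
  lies above or below.\<close>

lemma strip_boundary_continuous:
  fixes f :: "complex \<Rightarrow> 'a::complex_normed_vector" and p s :: complex
  assumes r: "0 < r" and s: "s = 1 \<or> s = - 1"
    and sub: "\<And>w. 0 \<le> Im w \<Longrightarrow> Im w \<le> r \<Longrightarrow> p + s * w \<in> S"
    and int: "\<And>w. 0 < Im w \<Longrightarrow> Im w < r \<Longrightarrow> p + s * w \<in> interior S"
    and half: "\<And>w. w \<in> S \<Longrightarrow> 0 \<le> Im (s * (w - p))"
    and bdd: "bounded (f ` S)"
    and weak: "\<And>\<mu>. \<mu> \<in> dual_space \<Longrightarrow> continuous_on S (\<lambda>w. \<mu> (f w))"
    and ana: "analytic_in f (interior S)"
    and real: "continuous_on UNIV (\<lambda>t::real. f (p + of_real t))"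
  shows "continuous (at p within S) f"
proof -
  define g where "g = (\<lambda>w. f (p + s * w))"
  define H where "H = cball 0 r \<inter> {w. 0 \<le> Im w}"
  have H: "p + s * w \<in> S" if "w \<in> H" for w
    using that abs_Im_le_cmod[of w] by (intro sub) (auto simp: H_def)
  have "(g \<longlongrightarrow> g 0) (at 0 within {w. 0 \<le> Im w})"
  proof (rule half_disc_norm_continuous[OF r])
    show "bounded (g ` (cball 0 r \<inter> {w. 0 \<le> Im w}))"
      by (rule bounded_subset[OF bdd]) (use H in \<open>auto simp: g_def H_def\<close>)
  next
    fix \<mu> :: "'a \<Rightarrow> complex" assume \<mu>: "\<mu> \<in> dual_space"
    show "continuous_on (cball 0 r \<inter> {w. 0 \<le> Im w}) (\<lambda>w. \<mu> (g w))"
      unfolding g_def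
      by (rule continuous_on_compose2[OF weak[OF \<mu>]]) (use H in \<open>auto simp: H_def intro!: continuous_intros\<close>)
    have "(\<lambda>w. \<mu> (f w)) holomorphic_on interior S"
      using analytic_in_imp_weakly_differentiable[OF ana \<mu>]
      by (auto simp: holomorphic_on_def intro: field_differentiable_at_within)
    then have "((\<lambda>w. \<mu> (f w)) \<circ> (\<lambda>w. p + s * w)) holomorphic_on ball 0 r \<inter> {w. 0 < Im w}"
    proof (rule holomorphic_on_compose_gen[rotated])
      show "(\<lambda>w. p + s * w) holomorphic_on ball 0 r \<inter> {w. 0 < Im w}"
        by (intro holomorphic_intros)
      have "Im w < r" if "cmod w < r" for w using that abs_Im_le_cmod[of w] by simp
      then show "(\<lambda>w. p + s * w) ` (ball 0 r \<inter> {w. 0 < Im w}) \<subseteq> interior S"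
        using int by auto
    qed
    then show "(\<lambda>w. \<mu> (g w)) holomorphic_on ball 0 r \<inter> {w. 0 < Im w}"
      by (simp add: g_def o_def)
  next
    \<comment> \<open>Since \<open>s\<close> is a real sign, \<open>g\<close> on the real axis is
      \<open>f\<close> along the boundary line, possibly traversed backwards.\<close>
    have "continuous_on UNIV (\<lambda>t::real. f (p + of_real (Re s * t)))"
      by (rule continuous_on_compose2[OF real]) (auto intro!: continuous_intros)
    moreover have "of_real (Re s * t) = s * of_real t" for t using s by auto
    ultimately have "continuous_on UNIV (\<lambda>t::real. g (of_real t))" by (simp only: g_def)
    then show "isCont (\<lambda>t::real. g (of_real t)) 0"
      by (simp add: continuous_on_eq_continuous_at)
  qed
  then have "continuous (at 0 within {w. 0 \<le> Im w}) g" by (simp add: continuous_within)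
  \<comment> \<open>By \<open>half\<close>, the pulled-back set lies in the closed upper half plane,
    so the limit there restricts to it.\<close>
  then have "continuous (at 0 within (\<lambda>w. s * (w - p)) ` S) g"
    by (rule continuous_within_subset) (use half in auto)
  then have "continuous (at p within S) (g \<circ> (\<lambda>w. s * (w - p)))"
    by (intro continuous_within_compose) (auto intro!: continuous_intros)
  \<comment> \<open>Thus \<open>w \<mapsto> s * (w - p)\<close> inverts the change of
    variable.\<close>
  moreover have "s * s = 1" using s by auto
  then have "g (s * (w - p)) = f w" for w by (simp add: g_def flip: mult.assoc)
  ultimately show ?thesis by (simp add: o_def)
qed

section \<open>Norm continuity on the whole strip\<close>

theorem theorem2p6:
  fixes z :: complex and f :: "complex \<Rightarrow> 'a::complex_banach"
  assumes "bounded (f ` strip z)"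
    and "weakly_regular z f"
    and "continuous_on UNIV (\<lambda>t::real. f (complex_of_real t))"
    and "continuous_on UNIV (\<lambda>t::real. f (z + complex_of_real t))"
  shows "norm_regular z f"
proof -
  have weak: "\<And>\<mu>. \<mu> \<in> dual_space \<Longrightarrow> continuous_on (strip z) (\<lambda>w. \<mu> (f w))"
    and ana: "analytic_in f (interior (strip z))"
    using assms(2) by (auto simp: weakly_regular_def continuous_map_weak_topology_iff)
  have "continuous_on (strip z) f"
  proof (cases "z \<in> \<real>")
    case True
    have "continuous_on \<real> (\<lambda>w. f (complex_of_real (Re w)))"
      by (rule continuous_on_compose2[OF assms(3)]) (auto intro!: continuous_intros)
    then have "continuous_on \<real> f"
      by (rule continuous_on_eq) (auto elim!: Reals_cases)
    then show ?thesis using True by (simp add: strip_def)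
  next
    case False
    then have z: "Im z \<noteq> 0" by (simp add: complex_is_Real_iff)
    have S: "strip z = {w. 0 \<le> Im w / Im z \<and> Im w / Im z \<le> 1}" using False by (simp add: strip_def)
    have interior: "w \<in> interior (strip z)" if "0 < Im w / Im z" "Im w / Im z < 1" for w
    proof (rule interiorI)
      show "open {w. 0 < Im w / Im z \<and> Im w / Im z < 1}"
        using z by (intro open_Collect_conj open_Collect_less continuous_intros) auto
    qed (use that in \<open>auto simp: S\<close>)
    \<comment> \<open>The strip lies below the real axis when \<open>Im z\<close> is negative;
      \<open>s\<close> is the inward sign at the real line and \<open>- s\<close> the one at the
      line through \<open>z\<close>.\<close>
    define s :: complex where "s = of_real (sgn (Im z))"
    have s: "s = 1 \<or> s = - 1" "- s = 1 \<or> - s = - 1" using z by (auto simp: s_def sgn_if)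
    have Im_s: "Im (s * w) / Im z = Im w / \<bar>Im z\<bar>" for w
      using z by (auto simp: s_def sgn_if abs_if)
    have r: "0 < \<bar>Im z\<bar>" using z by simp
    have "continuous (at p within strip z) f" if p: "p \<in> strip z" for p
    proof -
      \<comment> \<open>Two boundary lines and the interior. On either line the half disc may have
        the full width of the strip as radius.\<close>
      consider "Im p = 0" | "Im p = Im z" | "0 < Im p / Im z" "Im p / Im z < 1"
        using p z by (force simp: S)
      then show ?thesis
      proof cases
        case 1
        show ?thesis
        proof (rule strip_boundary_continuous[OF r s(1) _ _ _ assms(1) weak ana])
          have eq: "Im (p + s * w) / Im z = Im w / \<bar>Im z\<bar>" for w
            using 1 Im_s[of w] by simp
          show "p + s * w \<in> strip z" if "0 \<le> Im w" "Im w \<le> \<bar>Im z\<bar>" for w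
            unfolding S mem_Collect_eq eq using that r by simp
          show "p + s * w \<in> interior (strip z)" if "0 < Im w" "Im w < \<bar>Im z\<bar>" for w
            by (rule interior; unfold eq) (use that r in simp_all)
          show "0 \<le> Im (s * (w - p))" if "w \<in> strip z" for w
            using that 1 z by (auto simp: S s_def sgn_if zero_le_divide_iff)
          have "continuous_on UNIV (\<lambda>t::real. f (complex_of_real (Re p + t)))"
            by (rule continuous_on_compose2[OF assms(3)]) (auto intro!: continuous_intros)
          moreover have "complex_of_real (Re p + t) = p + complex_of_real t" for t
            using 1 by (simp add: complex_eq_iff)
          ultimately show "continuous_on UNIV (\<lambda>t::real. f (p + complex_of_real t))" by (simp only:)
        qed
      next
        case 2
        show ?thesis
        proof (rule strip_boundary_continuous[OF r s(2) _ _ _ assms(1) weak ana])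
          have eq: "Im (p + - s * w) / Im z = 1 - Im w / \<bar>Im z\<bar>" for w
            using 2 z Im_s[of w] by (simp add: diff_divide_distrib)
          show "p + - s * w \<in> strip z" if "0 \<le> Im w" "Im w \<le> \<bar>Im z\<bar>" for w
            unfolding S mem_Collect_eq eq using that r by simp
          show "p + - s * w \<in> interior (strip z)" if "0 < Im w" "Im w < \<bar>Im z\<bar>" for w
            by (rule interior; unfold eq) (use that r in simp_all)
          show "0 \<le> Im (- s * (w - p))" if "w \<in> strip z" for w
            using that 2 z by (auto simp: S s_def sgn_if divide_le_eq_1)
          \<comment> \<open>The point \<open>p\<close> is \<open>z\<close> shifted by the real
            number \<open>Re p - Re z\<close>, so continuity along the line through \<open>z\<close>
            is continuity along the line through \<open>p\<close>.\<close>
          have "continuous_on UNIV (\<lambda>t::real. f (z + complex_of_real (Re p - Re z + t)))"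
            by (rule continuous_on_compose2[OF assms(4)]) (auto intro!: continuous_intros)
          moreover have "z + complex_of_real (Re p - Re z + t) = p + complex_of_real t" for t
            using 2 by (simp add: complex_eq_iff)
          ultimately show "continuous_on UNIV (\<lambda>t::real. f (p + complex_of_real t))" by (simp only:)
        qed
      next
        case 3
        then have "p \<in> interior (strip z)" by (rule interior)
        then obtain D where "(f has_derivative (\<lambda>h. h *\<^sub>C D)) (at p)"
          using ana by (auto simp: analytic_in_def)
        then show ?thesis
          by (rule continuous_at_imp_continuous_at_within[OF has_derivative_continuous])
      qed
    qed
    then show ?thesis by (simp add: continuous_on_eq_continuous_within)
  qed
  then show ?thesis using ana by (simp add: norm_regular_def)
qed

end
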